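(* Let $\Gamma\subset\mathbb{R}^d$ be an acute closed convex solid cone, let $\lambda\in\operatorname{int}\Gamma$ be fixed, and let $\mu$ be a finite positive (Borel) measure on $\Gamma^*$. Then the measure $\mu$ is finitely supported in $\Gamma^*$ if and only if there exists $n\in\mathbb{N}$ such that $\operatorname{rank}K_n=\operatorname{rank}K_{n+1}$.
   Context: Acute means containing no line; solid means with non-empty interior. $\Gamma^*=\{y\in\mathbb{R}^d: y\cdot x\ge 0\ \forall x\in\Gamma\}$. For $n\in\mathbb{N}_0$, let $$\mathcal{M}_n=\operatorname{span}_{\mathbb{R}}\left\{\frac{x^\alpha}{(1+\lambda\cdot x)^{|\alpha|+j+1/2}}:(\alpha,j)\in\mathbb{N}_0^d\times\mathbb{N}_0,\ |\alpha|+j\le n\right\},$$ a space of real continuous functions on $\Gamma^*$, and let $K_n$ be the positive semi-definite bilinear form on $\mathcal{M}_n$ given by $K_n(f,g)=\int_{\Gamma^*}f(x)g(x)\,d\mu(x)$. The rank of $K_n$ is the rank of the matrix of this form (with respect to any fixed basis of $\mathcal{M}_n$); its values on the spanning functions are $\int_{\Gamma^*}\frac{x^{\alpha+\beta}}{(1+\lambda\cdot x)^{|\alpha|+|\beta|+j+k+1}}\,d\mu(x)$. *)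

theory Defs
  imports
    "HOL-Analysis.Analysis"
    "HOL-Library.Function_Algebras"
    "Jordan_Normal_Form.DL_Rank"
begin

no_notation vec_index (infixl \<open>$\<close> 100)
hide_type (open) Matrix.vec
hide_const (open) VectorSpace.subspace

text \<open>Real-valued functions form a real vector space under pointwise operations, so that the
  library's \<open>span\<close>, \<open>independent\<close> and \<open>dim\<close> apply to them.\<close>

instantiation "fun" :: (type, real_vector) real_vector
begin

definition scaleR_fun_def: "c *\<^sub>R f = (\<lambda>x. c *\<^sub>R f x)"

instance
  by standard (simp_all add: scaleR_fun_def fun_eq_iff scaleR_add_right scaleR_add_left)

end


subsection \<open>Rank of a bilinear form\<close>

definition is_basis_of :: "'v::real_vector list \<Rightarrow> 'v set \<Rightarrow> bool" where
  "is_basis_of bs V \<longleftrightarrow> distinct bs \<and> independent (set bs) \<and> span (set bs) = V"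

definition form_matrix :: "('v \<Rightarrow> 'v \<Rightarrow> real) \<Rightarrow> 'v list \<Rightarrow> real mat" where
  "form_matrix B bs = mat (length bs) (length bs) (\<lambda>(i, j). B (bs ! i) (bs ! j))"

text \<open>The choice of basis is immaterial when \<open>B\<close> is bilinear on \<open>V\<close>: see \<open>form_rank_eq\<close> below.
  The definition is only meaningful if \<open>V\<close> is a finite-dimensional subspace.\<close>

definition form_rank :: "'v::real_vector set \<Rightarrow> ('v \<Rightarrow> 'v \<Rightarrow> real) \<Rightarrow> nat" where
  "form_rank V B =
    (let bs = SOME bs. is_basis_of bs V in vec_space.rank (length bs) (form_matrix B bs))"

lemma sum_fun_apply: "(\<Sum>v\<in>A. (f v :: 'a \<Rightarrow> real)) x = (\<Sum>v\<in>A. f v x)"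
  by (induction A rule: infinite_finite_induct) auto

lemma rank_mat_eval_eq_dim:
  fixes hs :: "('v \<Rightarrow> real) list" and p :: "nat \<Rightarrow> 'v"
  assumes inj: "\<And>\<phi>. \<phi> \<in> span (set hs) \<Longrightarrow> (\<forall>i<n. \<phi> (p i) = 0) \<Longrightarrow> \<phi> = 0"
  shows "vec_space.rank n (mat n (length hs) (\<lambda>(i, j). (hs ! j) (p i))) = dim (set hs)"
proof -
  interpret V: vec_space "TYPE(real)" n .
  define R where "R = (\<lambda>\<phi> :: 'v \<Rightarrow> real. Matrix.vec n (\<lambda>i. \<phi> (p i)))"
  let ?A = "mat n (length hs) (\<lambda>(i, j). (hs ! j) (p i))"
  have colsA: "set (cols ?A) = R ` set hs"
  proof -
    have "set (cols ?A) = col ?A ` {..<length hs}"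
      by (auto simp: cols_def)
    also have "\<dots> = (\<lambda>j. R (hs ! j)) ` {..<length hs}"
      by (intro image_cong refl) (auto simp: R_def col_def)
    also have "\<dots> = R ` set hs"
      by (auto simp: set_conv_nth)
    finally show ?thesis .
  qed
  have R_inj: "inj_on R (span (set hs))"
  proof (rule inj_onI)
    fix \<phi> \<psi> assume *: "\<phi> \<in> span (set hs)" "\<psi> \<in> span (set hs)" "R \<phi> = R \<psi>"
    have "\<phi> (p i) = \<psi> (p i)" if "i < n" for i
      using arg_cong[OF *(3), of "\<lambda>v. vec_index v i"] that by (simp add: R_def)
    hence "\<phi> - \<psi> = 0"
      by (intro inj) (use * in \<open>auto intro: span_diff\<close>)
    thus "\<phi> = \<psi>" by simp
  qed
  have sub: "D \<subseteq> span (set hs)" if "D \<subseteq> set hs" for D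
    using that span_superset by blast
  have carr: "R ` D \<subseteq> carrier_vec n" for D
    by (auto simp: R_def)
  have lc: "V.lincomb a (R ` D) = R (\<Sum>\<phi>\<in>D. a (R \<phi>) *\<^sub>R \<phi>)" if D: "D \<subseteq> set hs" for a D
  proof (rule eq_vecI)
    show "dim_vec (V.lincomb a (R ` D)) = dim_vec (R (\<Sum>\<phi>\<in>D. a (R \<phi>) *\<^sub>R \<phi>))"
      using V.lincomb_dim[OF _ carr] finite_subset[OF D] by (simp add: R_def)
    fix i assume "i < dim_vec (R (\<Sum>\<phi>\<in>D. a (R \<phi>) *\<^sub>R \<phi>))"
    hence i: "i < n" by (simp add: R_def)
    have "vec_index (V.lincomb a (R ` D)) i = (\<Sum>x\<in>R ` D. a x * vec_index x i)"
      by (rule V.lincomb_index[OF i carr])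
    also have "\<dots> = (\<Sum>\<phi>\<in>D. a (R \<phi>) * vec_index (R \<phi>) i)"
      by (subst sum.reindex) (use inj_on_subset[OF R_inj sub[OF D]] in auto)
    also have "\<dots> = vec_index (R (\<Sum>\<phi>\<in>D. a (R \<phi>) *\<^sub>R \<phi>)) i"
      using i by (simp add: R_def sum_fun_apply scaleR_fun_def)
    finally show "vec_index (V.lincomb a (R ` D)) i = vec_index (R (\<Sum>\<phi>\<in>D. a (R \<phi>) *\<^sub>R \<phi>)) i" .
  qed
  have R0: "R \<phi> = 0\<^sub>v n \<longleftrightarrow> \<phi> = 0" if "\<phi> \<in> span (set hs)" for \<phi>
    using that inj[of \<phi>] by (auto simp: R_def vec_eq_iff)
  have indep: "V.lin_indpt (R ` D) \<longleftrightarrow> independent D" if D: "D \<subseteq> set hs" for D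
  proof -
    have injD: "inj_on R D" using inj_on_subset[OF R_inj sub[OF D]] .
    have "V.lin_dep (R ` D) \<longleftrightarrow>
       (\<exists>E a. E \<subseteq> D \<and> R (\<Sum>\<phi>\<in>E. a (R \<phi>) *\<^sub>R \<phi>) = 0\<^sub>v n \<and> (\<exists>v\<in>E. a (R v) \<noteq> 0))"
      (is "_ = ?r")
    proof
      assume "V.lin_dep (R ` D)"
      then obtain X a v where X: "X \<subseteq> R ` D" "V.lincomb a X = 0\<^sub>v n" "v \<in> X" "a v \<noteq> 0"
        unfolding V.lin_dep_def by auto
      from X(1) obtain E where E: "E \<subseteq> D" "X = R ` E" by (meson subset_imageE)
      show ?r using X E lc[of E a] D by (intro exI[of _ E] exI[of _ a]) auto
    next
      assume ?r
      then obtain E a v where E: "E \<subseteq> D" "R (\<Sum>\<phi>\<in>E. a (R \<phi>) *\<^sub>R \<phi>) = 0\<^sub>v n" "v \<in> E" "a (R v) \<noteq> 0"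
        by blast
      have "finite E" using finite_subset[OF subset_trans[OF E(1) D]] by simp
      thus "V.lin_dep (R ` D)" unfolding V.lin_dep_def
        using E lc[of E a] D by (intro exI[of _ "R ` E"] exI[of _ a] exI[of _ "R v"]) auto
    qed
    also have "\<dots> \<longleftrightarrow> (\<exists>E a. E \<subseteq> D \<and> (\<Sum>\<phi>\<in>E. a (R \<phi>) *\<^sub>R \<phi>) = 0 \<and> (\<exists>v\<in>E. a (R v) \<noteq> 0))"
    proof -
      have "R (\<Sum>\<phi>\<in>E. a (R \<phi>) *\<^sub>R \<phi>) = 0\<^sub>v n \<longleftrightarrow> (\<Sum>\<phi>\<in>E. a (R \<phi>) *\<^sub>R \<phi>) = 0" if "E \<subseteq> D" for E a
        by (rule R0, intro span_sum span_scale span_base) (use that D in blast)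
      thus ?thesis by blast
    qed
    also have "\<dots> \<longleftrightarrow> dependent D"
    proof
      assume "\<exists>E a. E \<subseteq> D \<and> (\<Sum>\<phi>\<in>E. a (R \<phi>) *\<^sub>R \<phi>) = 0 \<and> (\<exists>v\<in>E. a (R v) \<noteq> 0)"
      then obtain E a where E: "E \<subseteq> D" "(\<Sum>\<phi>\<in>E. a (R \<phi>) *\<^sub>R \<phi>) = 0" "\<exists>v\<in>E. a (R v) \<noteq> 0"
        by blast
      moreover have "finite E" using finite_subset[OF subset_trans[OF E(1) D]] by simp
      ultimately show "dependent D"
        unfolding dependent_explicit by (intro exI[of _ E] exI[of _ "\<lambda>v. a (R v)"]) auto
    next
      assume "dependent D"
      then obtain E u where E: "E \<subseteq> D" "(\<Sum>v\<in>E. u v *\<^sub>R v) = 0" "\<exists>v\<in>E. u v \<noteq> 0"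
        unfolding dependent_explicit by blast
      have [simp]: "the_inv_into D R (R v) = v" if "v \<in> E" for v
        using that E(1) injD by (auto intro: the_inv_into_f_f)
      show "\<exists>E a. E \<subseteq> D \<and> (\<Sum>\<phi>\<in>E. a (R \<phi>) *\<^sub>R \<phi>) = 0 \<and> (\<exists>v\<in>E. a (R v) \<noteq> 0)"
        using E by (intro exI[of _ E] exI[of _ "\<lambda>w. u (the_inv_into D R w)"]) auto
    qed
    finally show ?thesis by blast
  qed
  obtain D where D: "D \<subseteq> set hs" "independent D" "set hs \<subseteq> span D" "card D = dim (set hs)"
    using basis_exists by blast
  have "maximal (R ` D) (\<lambda>T. T \<subseteq> set (cols ?A) \<and> V.lin_indpt T)"
    unfolding maximal_def
  proof (intro conjI allI impI)
    show "R ` D \<subseteq> set (cols ?A)" using D(1) colsA by auto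
    show "V.lin_indpt (R ` D)" using D indep by blast
    fix B assume B: "R ` D \<subseteq> B \<and> B \<subseteq> set (cols ?A) \<and> V.lin_indpt B"
    then obtain E where E: "E \<subseteq> set hs" "B = R ` E" unfolding colsA by (meson subset_imageE)
    have iE: "independent E" using B E indep by blast
    have DE: "D \<subseteq> E"
      using B E D(1) R_inj sub by (metis inj_on_image_subset_iff)
    have "E \<subseteq> D"
    proof
      fix e assume e: "e \<in> E"
      show "e \<in> D"
      proof (rule ccontr)
        assume "e \<notin> D"
        hence "e \<in> span (E - {e})"
          using D(3) E(1) e DE span_mono[of D "E - {e}"] by blast
        thus False using iE e dependent_def by blast
      qed
    qed
    thus "B = R ` D" using DE E by blast
  qed
  hence "V.rank ?A = card (R ` D)"
    by (intro V.rank_card_indpt[of _ "length hs"]) auto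
  also have "\<dots> = card D"
    using inj_on_subset[OF R_inj sub[OF D(1)]] by (rule card_image)
  finally show ?thesis using D by simp
qed

lemma rank_form_matrix:
  fixes B :: "'v::real_vector \<Rightarrow> 'v \<Rightarrow> real"
  assumes bs: "is_basis_of bs V"
    and add_left: "\<And>f g h. f \<in> V \<Longrightarrow> g \<in> V \<Longrightarrow> h \<in> V \<Longrightarrow> B (f + g) h = B f h + B g h"
    and scale_left: "\<And>c f h. f \<in> V \<Longrightarrow> h \<in> V \<Longrightarrow> B (c *\<^sub>R f) h = c * B f h"
    and add_right: "\<And>f g h. f \<in> V \<Longrightarrow> g \<in> V \<Longrightarrow> h \<in> V \<Longrightarrow> B f (g + h) = B f g + B f h"
    and scale_right: "\<And>c f h. f \<in> V \<Longrightarrow> h \<in> V \<Longrightarrow> B f (c *\<^sub>R h) = c * B f h"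
  shows "vec_space.rank (length bs) (form_matrix B bs) =
    dim ((\<lambda>g f. if f \<in> V then B f g else 0) ` V)"
proof -
  define T where "T = (\<lambda>g f. if f \<in> V then B f g else 0)"
  have V: "V = span (set bs)" using bs by (simp add: is_basis_of_def)
  have sV: "subspace V" by (simp add: V)
  have T_sum: "g \<in> V \<and> T g \<in> span (T ` set bs)" if "g \<in> span (set bs)" for g
    using that
  proof (induction rule: span_induct_alt)
    case base
    have "0 \<in> V" using sV by (simp add: subspace_0)
    moreover have "T 0 = 0"
      using scale_right[of _ 0 0] \<open>0 \<in> V\<close> by (auto simp: T_def fun_eq_iff)
    ultimately show ?case using span_zero[of "T ` set bs"] by metis
  next
    case (step c x y)
    have xy: "x \<in> V" "y \<in> V" using step by (auto simp: V intro: span_base)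
    have "T (c *\<^sub>R x + y) = c *\<^sub>R T x + T y"
      using xy sV by (auto simp: T_def fun_eq_iff scaleR_fun_def add_right scale_right subspace_scale)
    moreover have "c *\<^sub>R T x + T y \<in> span (T ` set bs)"
    proof (rule span_add)
      show "c *\<^sub>R T x \<in> span (T ` set bs)"
        by (intro span_scale span_base imageI step(1))
      show "T y \<in> span (T ` set bs)" using step(2) by simp
    qed
    moreover have "c *\<^sub>R x + y \<in> V"
      using xy sV by (simp add: subspace_add subspace_scale)
    ultimately show ?case by metis
  qed
  have lin: "\<phi> (c *\<^sub>R f) = c * \<phi> f \<and> \<phi> (f + g) = \<phi> f + \<phi> g"
    if "\<phi> \<in> span (T ` set bs)" "f \<in> V" "g \<in> V" for \<phi> f g c
    using that(1)
  proof (induction rule: span_induct_alt)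
    case base
    then show ?case by simp
  next
    case (step d x y)
    from step(1) obtain b where b: "b \<in> V" "x = T b" unfolding V by (auto intro: span_base)
    have V': "c *\<^sub>R f \<in> V" "f + g \<in> V"
      using sV that(2,3) by (auto intro: subspace_scale subspace_add)
    have "x (c *\<^sub>R f) = c * x f" "x (f + g) = x f + x g"
      using that(2,3) b V' by (simp_all add: T_def add_left scale_left)
    with step(2) show ?case
      by (simp add: scaleR_fun_def distrib_left mult.left_commute)
  qed
  have out: "\<phi> f = 0" if "\<phi> \<in> span (T ` set bs)" "f \<notin> V" for \<phi> f
    using that(1)
    by (induction rule: span_induct_alt) (use that(2) in \<open>auto simp: T_def scaleR_fun_def\<close>)
  have inj: "\<phi> = 0" if \<phi>: "\<phi> \<in> span (set (map T bs))" and z: "\<forall>i<length bs. \<phi> (bs ! i) = 0" for \<phi>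
  proof
    have \<phi>': "\<phi> \<in> span (T ` set bs)" using \<phi> by simp
    fix f
    show "\<phi> f = 0 f"
    proof (cases "f \<in> V")
      case True
      have "f \<in> V \<and> \<phi> f = 0" using True[unfolded V]
      proof (induction rule: span_induct_alt)
        case base
        have "0 \<in> V" using sV by (simp add: subspace_0)
        with lin[OF \<phi>' this this, of 0] show ?case by simp
      next
        case (step c x y)
        from step(1) have "x \<in> V" unfolding V by (rule span_base)
        moreover have "\<phi> x = 0" using step(1) z by (auto simp: in_set_conv_nth)
        moreover from calculation have "c *\<^sub>R x \<in> V"
          using sV by (simp add: subspace_scale)
        moreover have "c *\<^sub>R x + y \<in> V"
          using sV \<open>c *\<^sub>R x \<in> V\<close> step(2) by (simp add: subspace_add)
        moreover have "\<phi> (c *\<^sub>R x + y) = c * \<phi> x + \<phi> y"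
          using lin[OF \<phi>' \<open>x \<in> V\<close> \<open>x \<in> V\<close>, of c] lin[OF \<phi>' \<open>c *\<^sub>R x \<in> V\<close>, of y] step(2)
          by metis
        ultimately show ?case using step(2) by simp
      qed
      thus ?thesis by simp
    qed (use out[OF \<phi>'] in simp)
  qed
  have "form_matrix B bs = mat (length bs) (length (map T bs)) (\<lambda>(i, j). (map T bs ! j) (bs ! i))"
    unfolding form_matrix_def
    by (rule eq_matI) (auto simp: T_def V span_base)
  hence "vec_space.rank (length bs) (form_matrix B bs) = dim (set (map T bs))"
    using rank_mat_eval_eq_dim[of "map T bs" "length bs" "\<lambda>i. bs ! i"] inj by simp
  also have "\<dots> = dim (T ` V)"
    by (rule span_eq_dim, rule span_eq[THEN iffD2])
       (use T_sum V in \<open>auto intro: span_base\<close>)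
  finally show ?thesis unfolding T_def .
qed

lemma form_rank_eq:
  fixes B :: "'v::real_vector \<Rightarrow> 'v \<Rightarrow> real"
  assumes bs: "is_basis_of bs V"
    and bil: "\<And>f g h. f \<in> V \<Longrightarrow> g \<in> V \<Longrightarrow> h \<in> V \<Longrightarrow> B (f + g) h = B f h + B g h"
      "\<And>c f h. f \<in> V \<Longrightarrow> h \<in> V \<Longrightarrow> B (c *\<^sub>R f) h = c * B f h"
      "\<And>f g h. f \<in> V \<Longrightarrow> g \<in> V \<Longrightarrow> h \<in> V \<Longrightarrow> B f (g + h) = B f g + B f h"
      "\<And>c f h. f \<in> V \<Longrightarrow> h \<in> V \<Longrightarrow> B f (c *\<^sub>R h) = c * B f h"
  shows "form_rank V B = vec_space.rank (length bs) (form_matrix B bs)"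
proof -
  have ex: "is_basis_of (SOME bs. is_basis_of bs V) V"
    using bs by (rule someI)
  show ?thesis
    unfolding form_rank_def Let_def
    using rank_form_matrix[of _ V B, OF ex bil] rank_form_matrix[of bs V B, OF bs bil] by simp
qed


subsection \<open>Cones\<close>

definition acute :: "'a::real_vector set \<Rightarrow> bool" where
  "acute S \<longleftrightarrow> \<not> (\<exists>a v. v \<noteq> 0 \<and> (\<forall>t::real. a + t *\<^sub>R v \<in> S))"

definition solid :: "'a::topological_space set \<Rightarrow> bool" where
  "solid S \<longleftrightarrow> interior S \<noteq> {}"

definition dual_cone :: "'a::real_inner set \<Rightarrow> 'a set" where
  "dual_cone S = {y. \<forall>x\<in>S. inner y x \<ge> 0}"


subsection \<open>The function spaces and the forms\<close>

definition mindex_abs :: "('d::finite \<Rightarrow> nat) \<Rightarrow> nat" where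
  "mindex_abs \<alpha> = (\<Sum>i\<in>UNIV. \<alpha> i)"

definition monomial :: "('d::finite \<Rightarrow> nat) \<Rightarrow> real^'d \<Rightarrow> real" where
  "monomial \<alpha> x = (\<Prod>i\<in>UNIV. (x $ i) ^ \<alpha> i)"

text \<open>Functions on the dual cone are represented by their extension by 0 to the whole space;
  hence equality and linear independence are those of functions on the dual cone.\<close>

definition gen_fun ::
  "(real^'d::finite) set \<Rightarrow> real^'d \<Rightarrow> ('d \<Rightarrow> nat) \<Rightarrow> nat \<Rightarrow> real^'d \<Rightarrow> real" where
  "gen_fun \<Gamma> l \<alpha> j = (\<lambda>x. if x \<in> dual_cone \<Gamma>
     then monomial \<alpha> x / (1 + inner l x) powr (real (mindex_abs \<alpha>) + real j + 1 / 2) else 0)"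

definition M_space :: "(real^'d::finite) set \<Rightarrow> real^'d \<Rightarrow> nat \<Rightarrow> (real^'d \<Rightarrow> real) set" where
  "M_space \<Gamma> l n = span {gen_fun \<Gamma> l \<alpha> j | \<alpha> j. mindex_abs \<alpha> + j \<le> n}"

text \<open>For \<open>\<mu>\<close> a measure on (the Borel subsets of) the dual cone, \<open>space \<mu>\<close> is the dual cone, so this is
  the integral over the dual cone. \<open>K\<^sub>n\<close> is the restriction of this form to \<open>M_space \<Gamma> l n\<close>.\<close>

definition K_form :: "'a measure \<Rightarrow> ('a \<Rightarrow> real) \<Rightarrow> ('a \<Rightarrow> real) \<Rightarrow> real" where
  "K_form \<mu> f g = (LINT x|\<mu>. f x * g x)"

lemma ex_basis_M_space: "\<exists>bs. is_basis_of bs (M_space \<Gamma> l n)"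
proof -
  let ?I = "{(\<alpha> :: 'a \<Rightarrow> nat, j). mindex_abs \<alpha> + j \<le> n}"
  let ?G = "{gen_fun \<Gamma> l \<alpha> j | \<alpha> j. mindex_abs \<alpha> + j \<le> n}"
  have "?I \<subseteq> (PiE UNIV (\<lambda>_. {..n})) \<times> {..n}"
  proof clarify
    fix \<alpha> :: "'a \<Rightarrow> nat" and j assume *: "mindex_abs \<alpha> + j \<le> n"
    have "\<alpha> i \<le> mindex_abs \<alpha>" for i
      unfolding mindex_abs_def by (rule member_le_sum) auto
    with * have "\<alpha> i \<le> n" for i
      by (meson add_leD1 le_trans)
    thus "\<alpha> \<in> PiE UNIV (\<lambda>_. {..n}) \<and> j \<in> {..n}" using * by (auto simp: PiE_def)
  qed
  hence I: "finite ?I" by (rule finite_subset) (auto intro!: finite_cartesian_product finite_PiE)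
  have G: "?G = (\<lambda>(\<alpha>, j). gen_fun \<Gamma> l \<alpha> j) ` ?I" by auto
  have fin: "finite ?G" unfolding G by (rule finite_imageI[OF I])
  obtain D where D: "D \<subseteq> ?G" "independent D" "?G \<subseteq> span D"
    by (rule maximal_independent_subset[of ?G])
  obtain bs where bs: "set bs = D" "distinct bs"
    using finite_distinct_list[OF finite_subset[OF D(1) fin]] by blast
  have "span D = M_space \<Gamma> l n"
    unfolding M_space_def by (rule antisym[OF span_mono[OF D(1)] span_minimal[OF D(3) subspace_span]])
  with bs D(2) have "is_basis_of bs (M_space \<Gamma> l n)"
    unfolding is_basis_of_def by simp
  thus ?thesis ..
qed

lemma K_form_gen_fun:
  assumes "space \<mu> = dual_cone \<Gamma>" and "l \<in> \<Gamma>"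
  shows "K_form \<mu> (gen_fun \<Gamma> l \<alpha> j) (gen_fun \<Gamma> l \<beta> k) =
    (LINT x|\<mu>. monomial (\<lambda>i. \<alpha> i + \<beta> i) x /
       (1 + inner l x) ^ (mindex_abs \<alpha> + mindex_abs \<beta> + j + k + 1))"
  unfolding K_form_def
proof (rule Bochner_Integration.integral_cong)
  fix x assume "x \<in> space \<mu>"
  hence x: "x \<in> dual_cone \<Gamma>" using assms by simp
  hence pos: "1 + inner l x > 0"
    using assms(2) by (force simp: dual_cone_def inner_commute)
  have m: "monomial (\<lambda>i. \<alpha> i + \<beta> i) x = monomial \<alpha> x * monomial \<beta> x"
    by (simp add: monomial_def power_add prod.distrib)
  have "(1 + inner l x) powr (real (mindex_abs \<alpha>) + real j + 1 / 2) *
        (1 + inner l x) powr (real (mindex_abs \<beta>) + real k + 1 / 2) =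
        (1 + inner l x) powr real (mindex_abs \<alpha> + mindex_abs \<beta> + j + k + 1)"
    unfolding powr_add[symmetric] by (rule arg_cong[of _ _ "(powr) _"]) simp
  also have "\<dots> = (1 + inner l x) ^ (mindex_abs \<alpha> + mindex_abs \<beta> + j + k + 1)"
    using pos by (rule powr_realpow)
  finally show "gen_fun \<Gamma> l \<alpha> j x * gen_fun \<Gamma> l \<beta> k x =
      monomial (\<lambda>i. \<alpha> i + \<beta> i) x / (1 + inner l x) ^ (mindex_abs \<alpha> + mindex_abs \<beta> + j + k + 1)"
    using x by (simp add: gen_fun_def m)
qed simp


subsection \<open>Finitely supported measures\<close>

text \<open>The topological support, with respect to the subspace topology on \<open>space \<mu>\<close>.\<close>

definition msupport :: "'a::topological_space measure \<Rightarrow> 'a set" where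
  "msupport \<mu> = {x \<in> space \<mu>. \<forall>U. open U \<longrightarrow> x \<in> U \<longrightarrow> emeasure \<mu> (U \<inter> space \<mu>) > 0}"

definition finitely_supported :: "'a::topological_space measure \<Rightarrow> bool" where
  "finitely_supported \<mu> \<longleftrightarrow> finite (msupport \<mu>)"

text \<open>Equivalently, the measure is concentrated on finitely many points.\<close>

lemma finitely_supported_iff:
  fixes \<mu> :: "'a::{second_countable_topology, t1_space} measure"
  assumes "sets \<mu> = sets (restrict_space borel S)"
  shows "finitely_supported \<mu> \<longleftrightarrow> (\<exists>F. finite F \<and> F \<subseteq> S \<and> emeasure \<mu> (S - F) = 0)"
proof -
  have sp: "space \<mu> = S" using sets_eq_imp_space_eq[OF assms] by (simp add: space_restrict_space)
  have meas: "U \<inter> S \<in> sets \<mu>" if "U \<in> sets borel" for U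
    using that by (auto simp: assms sets_restrict_space)
  show ?thesis
  proof
    assume fin: "finitely_supported \<mu>"
    define \<U> where "\<U> = {U. open U \<and> emeasure \<mu> (U \<inter> S) = 0}"
    obtain \<U>' where U': "\<U>' \<subseteq> \<U>" "countable \<U>'" "\<Union>\<U>' = \<Union>\<U>"
      using Lindelof[of \<U>] unfolding \<U>_def by auto
    have "(\<Union>U\<in>\<U>'. U \<inter> S) \<in> null_sets \<mu>"
    proof (rule null_sets_UN')
      fix U assume "U \<in> \<U>'"
      hence "open U" "emeasure \<mu> (U \<inter> S) = 0" using U'(1) by (auto simp: \<U>_def)
      thus "U \<inter> S \<in> null_sets \<mu>" using meas[of U] by auto
    qed (use U' in auto)
    moreover have "(\<Union>U\<in>\<U>'. U \<inter> S) = S - msupport \<mu>"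
      using U'(3) by (auto simp: msupport_def \<U>_def sp set_eq_iff)
    ultimately have "emeasure \<mu> (S - msupport \<mu>) = 0" by auto
    thus "\<exists>F. finite F \<and> F \<subseteq> S \<and> emeasure \<mu> (S - F) = 0"
      using fin by (intro exI[of _ "msupport \<mu>"]) (auto simp: finitely_supported_def msupport_def sp)
  next
    assume "\<exists>F. finite F \<and> F \<subseteq> S \<and> emeasure \<mu> (S - F) = 0"
    then obtain F where F: "finite F" "F \<subseteq> S" "emeasure \<mu> (S - F) = 0" by blast
    have op: "open (- F)" using F(1) by (simp add: finite_imp_closed open_Compl)
    have "- F \<inter> S = S - F" by blast
    hence "msupport \<mu> \<subseteq> F" using op F(3) unfolding msupport_def sp by fastforce
    thus "finitely_supported \<mu>" using F(1) finite_subset unfolding finitely_supported_def by blast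
  qed
qed

end

theory Submission
  imports Defs
begin

text \<open>In the coordinates \<open>y = x / (1 + \<lambda> \<bullet> x)\<close> and \<open>s = 1 / (1 + \<lambda> \<bullet> x)\<close>, which are bounded on the
  dual cone, \<open>M_space \<Gamma> \<lambda> n\<close> consists of \<open>s\<^bsup>1/2\<^esup>\<close> times the polynomials of degree at most \<open>n\<close> in
  \<open>(y, s)\<close>. As its elements are continuous, the rank of \<open>K\<^sub>n\<close> is the dimension of the space \<open>W\<^sub>n\<close> of
  restrictions of these functions to the support of the measure. If the support is finite, these
  dimensions are bounded by its cardinality, so they cannot increase forever. Conversely, if
  \<open>dim W\<^sub>n = dim W\<^sub>n\<^sub>+\<^sub>1\<close>, then \<open>W\<^sub>n = W\<^sub>n\<^sub>+\<^sub>1\<close> is a finite-dimensional space closed under multiplication by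
  the functions \<open>y\<^sub>i\<close> and \<open>s\<close>, which separate points; Lagrange interpolation within \<open>W\<^sub>n\<close> then bounds
  the number of points of the support by \<open>dim W\<^sub>n\<close>.\<close>

subsection \<open>Linear algebra\<close>

text \<open>\<open>dim\<close> is 0 on infinite-dimensional sets, so monotonicity is stated under a
  finite spanning set for the larger set.\<close>

lemma dim_subset_finite:
  fixes U W :: "'v::real_vector set"
  assumes "U \<subseteq> W" and "W \<subseteq> span B" and "finite B"
  shows "dim U \<le> dim W"
proof -
  obtain C where C: "C \<subseteq> W" "independent C" "W \<subseteq> span C" "card C = dim W"
    using basis_exists by blast
  have "finite C"
    using independent_span_bound[OF assms(3) C(2)] C(1) assms(2) by blast
  thus ?thesis using dim_le_card[of U C] C(3,4) assms(1) by auto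
qed

text \<open>A vector of \<open>W\<close> outside \<open>U\<close> would extend a basis of
  \<open>U\<close> to an independent subset of \<open>W\<close> with more than \<open>dim W\<close>
  elements.\<close>

lemma subspace_eq_if_dim_eq:
  fixes U W :: "'v::real_vector set"
  assumes "subspace U" and "U \<subseteq> W" and "W \<subseteq> span B" and "finite B" and "dim U = dim W"
  shows "U = W"
proof -
  obtain C where C: "C \<subseteq> U" "independent C" "U \<subseteq> span C" "card C = dim U"
    using basis_exists by blast
  obtain D where D: "D \<subseteq> W" "independent D" "W \<subseteq> span D" "card D = dim W"
    using basis_exists by blast
  have finD: "finite D"
    using independent_span_bound[OF assms(4) D(2)] D(1) assms(3) by blast
  have finC: "finite C"
    using independent_span_bound[OF assms(4) C(2)] C(1) assms(2,3) by blast
  have "W \<subseteq> U"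
  proof
    fix w assume w: "w \<in> W"
    show "w \<in> U"
    proof (rule ccontr)
      assume "w \<notin> U"
      hence nw: "w \<notin> span C"
        using span_minimal[OF C(1) assms(1)] by blast
      hence "independent (insert w C)"
        using C(2) by (simp add: independent_insertI)
      moreover have "insert w C \<subseteq> span D" using w C(1) assms(2) D(3) by auto
      ultimately have "card (insert w C) \<le> card D"
        using independent_span_bound[OF finD] by blast
      moreover have "w \<notin> C" using nw span_base by blast
      ultimately show False using finC C(4) D(4) assms(5) by simp
    qed
  qed
  with assms(2) show ?thesis by blast
qed

text \<open>Both images are isomorphic to \<open>V\<close> modulo the common kernel. Linearity of
  \<open>T\<close> is asked on \<open>V\<close> only, because the map induced by a form is additive
  only where the integrals exist.\<close>

lemma dim_image_eq_if_same_kernel: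
  fixes S :: "'v::real_vector \<Rightarrow> 'a::real_vector" and T :: "'v \<Rightarrow> 'b::real_vector"
  assumes V: "subspace V" and S: "linear S"
    and T_add: "\<And>f g. f \<in> V \<Longrightarrow> g \<in> V \<Longrightarrow> T (f + g) = T f + T g"
    and T_scale: "\<And>c f. f \<in> V \<Longrightarrow> T (c *\<^sub>R f) = c *\<^sub>R T f"
    and ker: "\<And>f. f \<in> V \<Longrightarrow> T f = 0 \<longleftrightarrow> S f = 0"
  shows "dim (T ` V) = dim (S ` V)"
proof -
  obtain A where A: "A \<subseteq> V" "independent A" "V \<subseteq> span A"
    by (rule maximal_independent_subset)
  have spanA: "span A = V" using A(3) span_minimal[OF A(1) V] by blast
  \<comment> \<open>\<open>T'\<close> is linear on the whole space and agrees with \<open>T\<close>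
    on \<open>V\<close>, which makes the theory of linear maps applicable.\<close>
  obtain T' where T': "linear T'" "\<And>x. x \<in> A \<Longrightarrow> T' x = T x"
    using linear_independent_extend[OF A(2), of T] by blast
  have T0: "T 0 = 0" using T_scale[of 0 0] subspace_0[OF V] by simp
  have "x \<in> V \<and> T' x = T x" if "x \<in> span A" for x
    using that
  proof (induction rule: span_induct_alt)
    case base
    then show ?case using subspace_0[OF V] T0 linear_0[OF T'(1)] by simp
  next
    case (step c x y)
    have "x \<in> V" "y \<in> V" using step A(1) by auto
    then show ?case
      using step T' V
      by (simp add: T_add T_scale subspace_add subspace_scale linear_add linear_scale)
  qed
  hence T'_eq: "T' x = T x" if "x \<in> V" for x using that spanA by blast
  obtain g where g: "range g \<subseteq> V" "linear g" "\<And>w. w \<in> S ` V \<Longrightarrow> S (g w) = w"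
    using linear_exists_right_inverse_on[OF S V] by meson
  \<comment> \<open>\<open>h\<close> is the induced map sending \<open>S v\<close> to
    \<open>T v\<close>: the choice \<open>g (S v)\<close> of a preimage differs from
    \<open>v\<close> by an element of the common kernel.\<close>
  define h where "h = T' \<circ> g"
  have h: "linear h" unfolding h_def using g(2) T'(1) by (rule linear_compose)
  have h_S: "h (S v) = T v" if v: "v \<in> V" for v
  proof -
    have d: "g (S v) - v \<in> V" using g(1) v V by (auto intro: subspace_diff)
    have "S (g (S v) - v) = 0" using g(3) v by (simp add: linear_diff[OF S])
    hence "T' (g (S v) - v) = 0" using ker[OF d] T'_eq[OF d] by simp
    thus ?thesis using T'_eq[OF v] by (simp add: h_def linear_diff[OF T'(1)])
  qed
  obtain C where C: "C \<subseteq> S ` V" "independent C" "S ` V \<subseteq> span C" "card C = dim (S ` V)"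
    using basis_exists by blast
  have spanC: "span C = S ` V"
    using C(3) span_minimal[OF C(1) linear_subspace_image[OF S V]] by blast
  have image: "T ` V = h ` span C"
    unfolding spanC image_image by (rule image_cong) (simp_all add: h_S)
  have inj: "inj_on h (span C)"
    unfolding linear_inj_on_iff_eq_0[OF h subspace_span] unfolding spanC using h_S ker by simp
  have "span (h ` C) = T ` V" using linear_span_image[OF h] image by simp
  moreover have "independent (h ` C)"
    using linear_independent_injective_image[OF h C(2) inj] .
  ultimately have "dim (T ` V) = card (h ` C)"
    using dim_span_eq_card_independent by metis
  also have "\<dots> = card C"
    using inj_on_subset[OF inj span_superset] by (rule card_image)
  finally show ?thesis using C(4) by simp
qed

text \<open>Multiplying by \<open>u x - u q\<close>, where \<open>u\<close> separates
  \<open>p\<close> from \<open>q\<close>, stays in \<open>W\<close> and creates a zero at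
  \<open>q\<close> while keeping the value at \<open>p\<close> nonzero. Starting from
  \<open>h\<close>, this gives for finitely many points of \<open>S\<close> an independent family in
  \<open>W\<close>, one function per point, so there are at most \<open>card B\<close>
  points.\<close>

lemma finite_if_separated_by_multipliers:
  fixes W :: "('a \<Rightarrow> real) set" and U :: "('a \<Rightarrow> real) set"
  assumes W: "subspace W" "W \<subseteq> span B" "finite B"
    and mult: "\<And>u f. u \<in> U \<Longrightarrow> f \<in> W \<Longrightarrow> (\<lambda>x. u x * f x) \<in> W"
    and h: "h \<in> W" "\<And>x. x \<in> S \<Longrightarrow> h x \<noteq> 0"
    and sep: "\<And>x y. x \<in> S \<Longrightarrow> y \<in> S \<Longrightarrow> x \<noteq> y \<Longrightarrow> \<exists>u\<in>U. u x \<noteq> u y"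
  shows "finite S"
proof (rule ccontr)
  have interp: "\<exists>g\<in>W. g p \<noteq> 0 \<and> (\<forall>q\<in>F. g q = 0)"
    if "finite F" "F \<subseteq> S" "p \<in> S" "p \<notin> F" for p F
    using that
  proof (induction F rule: finite_induct)
    case empty
    then show ?case using h by blast
  next
    case (insert q F)
    then obtain g where g: "g \<in> W" "g p \<noteq> 0" "\<forall>q\<in>F. g q = 0" by auto
    obtain u where u: "u \<in> U" "u p \<noteq> u q" using sep[of p q] insert.prems by auto
    let ?g = "(\<lambda>x. u x * g x) - u q *\<^sub>R g"
    have "?g \<in> W" using mult[OF u(1) g(1)] g(1) W(1) by (intro subspace_diff subspace_scale)
    moreover have "?g x = (u x - u q) * g x" for x
      by (simp add: scaleR_fun_def algebra_simps)
    ultimately show ?case using g u by (intro bexI[of _ ?g]) auto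
  qed
  assume "infinite S"
  then obtain F where F: "F \<subseteq> S" "finite F" "card F = Suc (card B)"
    using infinite_arbitrarily_large by blast
  have "\<exists>g\<in>W. g p \<noteq> 0 \<and> (\<forall>q\<in>F - {p}. g q = 0)" if "p \<in> F" for p
    using that F by (intro interp) auto
  then obtain g where g: "\<And>p. p \<in> F \<Longrightarrow> g p \<in> W" "\<And>p. p \<in> F \<Longrightarrow> g p p \<noteq> 0"
      "\<And>p q. p \<in> F \<Longrightarrow> q \<in> F \<Longrightarrow> q \<noteq> p \<Longrightarrow> g p q = 0"
    by (metis Diff_iff singletonD)
  have inj: "inj_on g F" by (rule inj_onI) (metis g(2,3))
  have "independent (g ` F)"
    unfolding dependent_finite[OF finite_imageI[OF F(2)]]
  proof clarify
    fix c p assume c: "(\<Sum>v\<in>g ` F. c v *\<^sub>R v) = 0" "c (g p) \<noteq> 0" "p \<in> F"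
    \<comment> \<open>Evaluating the linear relation at \<open>p\<close> leaves only the term of
      \<open>g p\<close>.\<close>
    have "0 = (\<Sum>q\<in>F. c (g q) *\<^sub>R g q) p"
      using c(1) inj by (simp add: sum.reindex)
    also have "\<dots> = (\<Sum>q\<in>F. c (g q) * g q p)"
      by (simp add: sum_fun_apply scaleR_fun_def)
    also have "\<dots> = (\<Sum>q\<in>F. if q = p then c (g p) * g p p else 0)"
      by (rule sum.cong) (use g(3) c(3) in auto)
    also have "\<dots> = c (g p) * g p p" using F(2) c(3) by simp
    finally show False using c(2,3) g(2) by simp
  qed
  moreover have "g ` F \<subseteq> span B" using g(1) W(2) by blast
  ultimately have "card (g ` F) \<le> card B" using independent_span_bound[OF W(3)] by blast
  thus False using F(3) inj by (simp add: card_image)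
qed

text \<open>Extension by zero makes equality of restrictions to \<open>S\<close> an equality of
  total functions, so \<open>dim\<close> of their image is the dimension of the space of
  restrictions.\<close>

definition restrict_zero :: "'a set \<Rightarrow> ('a \<Rightarrow> real) \<Rightarrow> 'a \<Rightarrow> real" where
  "restrict_zero S f = (\<lambda>x. if x \<in> S then f x else 0)"

lemma linear_restrict_zero: "linear (restrict_zero S)"
  by (rule linearI) (auto simp: restrict_zero_def scaleR_fun_def)

text \<open>This bounds the dimension of every space of restrictions to a finite \<open>S\<close> by
  the number of its points.\<close>

lemma restrict_zero_in_span_indicators:
  assumes "finite S"
  shows "restrict_zero S f \<in> span ((\<lambda>p. indicator {p}) ` S)"
proof -
  have "restrict_zero S f = (\<Sum>p\<in>S. f p *\<^sub>R indicator {p})"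
    using assms by (auto simp: restrict_zero_def fun_eq_iff sum_fun_apply scaleR_fun_def indicator_def)
  also have "\<dots> \<in> span ((\<lambda>p. indicator {p}) ` S)"
    by (intro span_sum span_scale span_base imageI)
  finally show ?thesis .
qed


subsection \<open>The spaces \<open>M_space \<Gamma> l n\<close>\<close>

lemma inner_dual_cone_nonneg:
  assumes "l \<in> \<Gamma>" and "x \<in> dual_cone \<Gamma>"
  shows "inner l x \<ge> 0"
  using assms by (auto simp: dual_cone_def inner_commute)

text \<open>A ball of radius \<open>e\<close> around \<open>l\<close> lies in \<Gamma>. Testing
  \<open>x\<close> against its point furthest in direction \<open>- x\<close> gives
  \<open>e * norm x \<le> inner l x\<close>.\<close>

lemma dual_cone_norm_le:
  fixes l :: "'a::real_inner"
  assumes "l \<in> interior \<Gamma>"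
  shows "\<exists>C\<ge>0. \<forall>x\<in>dual_cone \<Gamma>. norm x \<le> C * inner l x"
proof -
  obtain e where e: "e > 0" "cball l e \<subseteq> \<Gamma>" using assms mem_interior_cball by blast
  have "norm x \<le> 1 / e * inner l x" if "x \<in> dual_cone \<Gamma>" for x
  proof (cases "x = 0")
    case False
    let ?y = "l - (e / norm x) *\<^sub>R x"
    have "?y \<in> cball l e" using e False by (simp add: dist_norm)
    hence "?y \<in> \<Gamma>" using e(2) by blast
    hence "0 \<le> inner x ?y" using that by (simp add: dual_cone_def)
    also have "inner x ?y = inner l x - e * norm x"
      using False by (simp add: inner_diff_right inner_commute power2_norm_eq_inner[symmetric] power2_eq_square)
    finally show ?thesis using e by (simp add: field_simps)
  qed simp
  with e show ?thesis by (intro exI[of _ "1 / e"]) auto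
qed

lemma abs_monomial_le: "\<bar>monomial \<alpha> x\<bar> \<le> norm x ^ mindex_abs \<alpha>"
  unfolding monomial_def mindex_abs_def power_sum abs_prod power_abs
  by (intro prod_mono conjI power_mono) (auto simp: component_le_norm_cart)

lemma continuous_on_gen_fun:
  assumes "l \<in> \<Gamma>"
  shows "continuous_on (dual_cone \<Gamma>) (gen_fun \<Gamma> l \<alpha> j)"
proof -
  have "continuous_on (dual_cone \<Gamma>) (\<lambda>x. monomial \<alpha> x /
      (1 + inner l x) powr (real (mindex_abs \<alpha>) + real j + 1 / 2))"
    unfolding monomial_def
    by (intro continuous_intros) (use inner_dual_cone_nonneg[OF assms] in force)+
  thus ?thesis by (rule continuous_on_eq) (simp add: gen_fun_def)
qed

text \<open>The numerator is at most a constant times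
  \<open>(1 + inner l x) ^ mindex_abs \<alpha>\<close>; the base is at least 1, so the larger
  exponent of the denominator absorbs this power.\<close>

lemma bounded_gen_fun:
  assumes "l \<in> interior \<Gamma>"
  shows "bounded (gen_fun \<Gamma> l \<alpha> j ` dual_cone \<Gamma>)"
proof -
  obtain C where C: "C \<ge> 0" "\<And>x. x \<in> dual_cone \<Gamma> \<Longrightarrow> norm x \<le> C * inner l x"
    using dual_cone_norm_le[OF assms] by blast
  have l: "l \<in> \<Gamma>" using assms interior_subset by blast
  have "\<bar>gen_fun \<Gamma> l \<alpha> j x\<bar> \<le> C ^ mindex_abs \<alpha>" if x: "x \<in> dual_cone \<Gamma>" for x
  proof -
    let ?b = "1 + inner l x"
    have b: "?b \<ge> 1" using inner_dual_cone_nonneg[OF l x] by simp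
    have "norm x \<le> C * ?b"
      using C(2)[OF x] C(1) by (simp add: algebra_simps)
    hence "norm x ^ mindex_abs \<alpha> \<le> C ^ mindex_abs \<alpha> * ?b ^ mindex_abs \<alpha>"
      by (metis norm_ge_zero power_mono power_mult_distrib)
    also have "\<dots> = C ^ mindex_abs \<alpha> * ?b powr real (mindex_abs \<alpha>)"
      using b by (simp add: powr_realpow)
    also have "\<dots> \<le> C ^ mindex_abs \<alpha> * ?b powr (real (mindex_abs \<alpha>) + real j + 1 / 2)"
      using b C(1) by (intro mult_left_mono powr_mono) auto
    finally have "\<bar>monomial \<alpha> x\<bar> \<le> C ^ mindex_abs \<alpha> * ?b powr (real (mindex_abs \<alpha>) + real j + 1 / 2)"
      using abs_monomial_le order_trans by blast
    thus ?thesis using b x by (simp add: gen_fun_def abs_divide divide_le_eq)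
  qed
  thus ?thesis by (auto simp: bounded_iff)
qed

text \<open>Boundedness makes products integrable for a finite measure; continuity turns vanishing
  almost everywhere into vanishing on the support.\<close>

lemma M_space_continuous_bounded:
  assumes "l \<in> interior \<Gamma>" and "f \<in> M_space \<Gamma> l n"
  shows "continuous_on (dual_cone \<Gamma>) f \<and> bounded (f ` dual_cone \<Gamma>)"
proof -
  have l: "l \<in> \<Gamma>" using assms(1) interior_subset by blast
  show ?thesis
    using assms(2) unfolding M_space_def
  proof (induction rule: span_induct_alt)
    case base
    then show ?case by (auto simp: zero_fun_def bounded_iff)
  next
    case (step c x y)
    from step(1) obtain \<alpha> j where "x = gen_fun \<Gamma> l \<alpha> j" by blast
    hence x: "continuous_on (dual_cone \<Gamma>) x" "bounded (x ` dual_cone \<Gamma>)"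
      using continuous_on_gen_fun[OF l] bounded_gen_fun[OF assms(1)] by auto
    have "c *\<^sub>R x + y = (\<lambda>z. c *\<^sub>R x z + y z)"
      by (simp add: fun_eq_iff scaleR_fun_def)
    moreover have "continuous_on (dual_cone \<Gamma>) (\<lambda>z. c *\<^sub>R x z + y z)"
      using x step(2) by (intro continuous_intros) auto
    moreover have "bounded ((\<lambda>z. c *\<^sub>R x z + y z) ` dual_cone \<Gamma>)"
      using x step(2) by (intro bounded_plus_comp bounded_scaleR_comp) auto
    ultimately show ?case by simp
  qed
qed

lemma subspace_M_space: "subspace (M_space \<Gamma> l n)"
  by (simp add: M_space_def)

lemma gen_fun_in_M_space: "mindex_abs \<alpha> + j \<le> n \<Longrightarrow> gen_fun \<Gamma> l \<alpha> j \<in> M_space \<Gamma> l n"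
  unfolding M_space_def by (rule span_base) blast

lemma M_space_mono: "m \<le> n \<Longrightarrow> M_space \<Gamma> l m \<subseteq> M_space \<Gamma> l n"
  unfolding M_space_def by (rule span_mono) fastforce

text \<open>These are \<open>s\<close> and the \<open>y\<^sub>i\<close>. They are not cut off
  outside the dual cone, since the functions that they multiply vanish there already.\<close>

definition coord_funs :: "real^'d::finite \<Rightarrow> (real^'d \<Rightarrow> real) set" where
  "coord_funs l = insert (\<lambda>x. 1 / (1 + inner l x)) (range (\<lambda>i x. x $ i / (1 + inner l x)))"

text \<open>The value of \<open>s\<close> determines \<open>inner l x\<close>, after which
  \<open>y\<^sub>i\<close> determines \<open>x $ i\<close>.\<close>

lemma coord_funs_separate:
  assumes "inner l x \<ge> 0" and "inner l y \<ge> 0" and "x \<noteq> y"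
  shows "\<exists>u\<in>coord_funs l. u x \<noteq> u y"
proof (rule ccontr)
  assume "\<not> ?thesis"
  hence eq: "1 / (1 + inner l x) = 1 / (1 + inner l y)"
    and eqi: "\<And>i. x $ i / (1 + inner l x) = y $ i / (1 + inner l y)"
    by (auto simp: coord_funs_def)
  from eq assms have "inner l x = inner l y" by (simp add: field_simps)
  moreover have "1 + inner l y \<noteq> 0" using assms(2) by linarith
  ultimately have "x $ i = y $ i" for i using eqi[of i] by simp
  with assms(3) show False by (simp add: Finite_Cartesian_Product.vec_eq_iff)
qed

text \<open>Multiplication by \<open>s\<close> raises \<open>j\<close> by one and multiplication by
  \<open>y\<^sub>i\<close> raises \<open>\<alpha> i\<close> by one; either way the exponent of the
  denominator grows by exactly one.\<close>

lemma coord_fun_mult_gen_fun: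
  assumes l: "l \<in> \<Gamma>" and u: "u \<in> coord_funs l"
  obtains \<beta> k where "mindex_abs \<beta> + k = Suc (mindex_abs \<alpha> + j)"
    "(\<lambda>x. u x * gen_fun \<Gamma> l \<alpha> j x) = gen_fun \<Gamma> l \<beta> k"
proof -
  have powr_Suc: "(1 + inner l x) powr (a + 1) = (1 + inner l x) * (1 + inner l x) powr a"
    if "x \<in> dual_cone \<Gamma>" for x a
    using inner_dual_cone_nonneg[OF l that] by (simp add: powr_add)
  from u consider "u = (\<lambda>x. 1 / (1 + inner l x))" | i where "u = (\<lambda>x. x $ i / (1 + inner l x))"
    by (auto simp: coord_funs_def)
  thus thesis
  proof cases
    case 1
    have "u x * gen_fun \<Gamma> l \<alpha> j x = gen_fun \<Gamma> l \<alpha> (Suc j) x" for x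
      using powr_Suc[of x "real (mindex_abs \<alpha>) + real j + 1 / 2"]
      by (simp add: gen_fun_def 1 algebra_simps)
    thus thesis by (intro that[of \<alpha> "Suc j"]) auto
  next
    case 2
    let ?\<beta> = "\<alpha>(i := Suc (\<alpha> i))"
    have abs: "mindex_abs ?\<beta> = Suc (mindex_abs \<alpha>)"
      by (simp add: mindex_abs_def sum.remove[of UNIV i])
    have mon: "monomial ?\<beta> x = x $ i * monomial \<alpha> x" for x
      by (simp add: monomial_def prod.remove[of UNIV i])
    have "u x * gen_fun \<Gamma> l \<alpha> j x = gen_fun \<Gamma> l ?\<beta> j x" for x
      using powr_Suc[of x "real (mindex_abs \<alpha>) + real j + 1 / 2"]
      by (simp add: gen_fun_def 2 abs mon algebra_simps)
    with abs show thesis by (intro that[of ?\<beta> j]) auto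
  qed
qed

lemma coord_fun_mult_M_space:
  assumes "l \<in> \<Gamma>" and u: "u \<in> coord_funs l" and "f \<in> M_space \<Gamma> l n"
  shows "(\<lambda>x. u x * f x) \<in> M_space \<Gamma> l (Suc n)"
  using assms(3) unfolding M_space_def[of _ _ n]
proof (induction rule: span_induct_alt)
  case base
  have "(\<lambda>x. u x * 0 x) = (0 :: real^'a \<Rightarrow> real)" by auto
  then show ?case using subspace_0[OF subspace_M_space] by simp
next
  case (step c x y)
  then obtain \<alpha> j where x: "x = gen_fun \<Gamma> l \<alpha> j" "mindex_abs \<alpha> + j \<le> n" by blast
  obtain \<beta> k where "mindex_abs \<beta> + k = Suc (mindex_abs \<alpha> + j)"
    "(\<lambda>z. u z * x z) = gen_fun \<Gamma> l \<beta> k"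
    using coord_fun_mult_gen_fun[OF assms(1,2)] x(1) by metis
  hence "(\<lambda>z. u z * x z) \<in> M_space \<Gamma> l (Suc n)"
    using x(2) by (simp add: gen_fun_in_M_space del: add_Suc_right)
  moreover have "(\<lambda>z. u z * (c *\<^sub>R x + y) z) = c *\<^sub>R (\<lambda>z. u z * x z) + (\<lambda>z. u z * y z)"
    by (simp add: fun_eq_iff scaleR_fun_def algebra_simps)
  ultimately show ?case
    using step(2) by (simp only: subspace_add[OF subspace_M_space] subspace_scale[OF subspace_M_space])
qed


subsection \<open>The rank of the forms\<close>

text \<open>The complement of the support is a union of relatively open null sets, and by the
  Lindelof property countably many of them cover it.\<close>

lemma AE_in_msupport:
  fixes \<mu> :: "'a::second_countable_topology measure"
  assumes "sets \<mu> = sets (restrict_space borel S)"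
  shows "AE x in \<mu>. x \<in> msupport \<mu>"
proof -
  have sp: "space \<mu> = S" using sets_eq_imp_space_eq[OF assms] by (simp add: space_restrict_space)
  have meas: "U \<inter> S \<in> sets \<mu>" if "open U" for U
    unfolding assms sets_restrict_space using that by (intro image_eqI[of _ _ U]) auto
  define \<U> where "\<U> = {U. open U \<and> emeasure \<mu> (U \<inter> S) = 0}"
  obtain \<U>' where U': "\<U>' \<subseteq> \<U>" "countable \<U>'" "\<Union>\<U>' = \<Union>\<U>"
    using Lindelof[of \<U>] unfolding \<U>_def by auto
  have "(\<Union>U\<in>\<U>'. U \<inter> S) \<in> null_sets \<mu>"
    using U'(1) meas by (intro null_sets_UN' U'(2)) (auto simp: \<U>_def)
  moreover have "{x \<in> space \<mu>. x \<notin> msupport \<mu>} \<subseteq> (\<Union>U\<in>\<U>'. U \<inter> S)"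
    using U'(3) by (auto simp: msupport_def \<U>_def sp)
  ultimately show ?thesis by (rule AE_I')
qed

text \<open>If \<open>f x\<close> were nonzero, the relatively open set where \<open>f\<close> is
  nonzero would be a null neighbourhood of a point of the support.\<close>

lemma continuous_AE_zero_on_msupport:
  fixes f :: "'a::topological_space \<Rightarrow> real"
  assumes sets: "sets \<mu> = sets (restrict_space borel S)"
    and f: "continuous_on S f" and AE: "AE x in \<mu>. f x = 0" and x: "x \<in> msupport \<mu>"
  shows "f x = 0"
proof (rule ccontr)
  assume "f x \<noteq> 0"
  have sp: "space \<mu> = S" using sets_eq_imp_space_eq[OF sets] by (simp add: space_restrict_space)
  obtain U where U: "open U" "U \<inter> S = f -` (- {0}) \<inter> S"
    using f continuous_on_open_invariant[of S f] by (metis open_Compl closed_singleton)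
  have "U \<inter> S \<in> sets \<mu>"
    unfolding sets sets_restrict_space using U(1) by (intro image_eqI[of _ _ U]) auto
  moreover have "AE x in \<mu>. x \<notin> U \<inter> S" using AE by eventually_elim (use U in auto)
  ultimately have "emeasure \<mu> (U \<inter> S) = 0"
    using AE_iff_null_sets[of "U \<inter> S" \<mu>] by auto
  moreover have "x \<in> U" using U(2) \<open>f x \<noteq> 0\<close> x sp by (auto simp: msupport_def)
  ultimately show False using x U(1) sp by (auto simp: msupport_def)
qed

text \<open>The rank is the dimension of the image of \<open>g \<mapsto> K(\<cdot>, g)\<close>. This
  map has the same kernel as restriction to the support, so the two images have equal
  dimension.\<close>

lemma form_rank_K_form:
  fixes \<Gamma> :: "(real^'d::finite) set"
  assumes l: "l \<in> interior \<Gamma>"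
    and sets: "sets \<mu> = sets (restrict_space borel (dual_cone \<Gamma>))"
    and "finite_measure \<mu>"
  shows "form_rank (M_space \<Gamma> l n) (K_form \<mu>) =
    dim (restrict_zero (msupport \<mu>) ` M_space \<Gamma> l n)"
proof -
  interpret finite_measure \<mu> by fact
  define V where "V = M_space \<Gamma> l n"
  have V: "subspace V" by (simp add: V_def subspace_M_space)
  have sp: "space \<mu> = dual_cone \<Gamma>"
    using sets_eq_imp_space_eq[OF sets] by (simp add: space_restrict_space)
  have cont: "continuous_on (dual_cone \<Gamma>) f" and bdd: "bounded (f ` dual_cone \<Gamma>)" if "f \<in> V" for f
    using M_space_continuous_bounded[OF l] that by (auto simp: V_def)
  have int: "integrable \<mu> (\<lambda>x. f x * g x)" if fg: "f \<in> V" "g \<in> V" for f g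
  proof -
    have "\<exists>A. \<forall>x\<in>dual_cone \<Gamma>. \<bar>h x\<bar> \<le> A" if "h \<in> V" for h
      using bdd[OF that] by (auto simp: bounded_iff)
    then obtain A B
      where AB: "\<And>x. x \<in> dual_cone \<Gamma> \<Longrightarrow> \<bar>f x\<bar> \<le> A" "\<And>x. x \<in> dual_cone \<Gamma> \<Longrightarrow> \<bar>g x\<bar> \<le> B"
      using fg by meson
    have "\<bar>f x\<bar> * \<bar>g x\<bar> \<le> A * B" if "x \<in> dual_cone \<Gamma>" for x
      using AB[OF that] by (intro mult_mono) auto
    hence "AE x in \<mu>. norm (f x * g x) \<le> A * B"
      by (intro AE_I2) (simp add: sp abs_mult)
    moreover have "(\<lambda>x. f x * g x) \<in> borel_measurable \<mu>"
      unfolding measurable_cong_sets[OF sets refl]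
      by (intro borel_measurable_continuous_on_restrict continuous_on_mult cont fg)
    ultimately show ?thesis by (rule integrable_const_bound)
  qed
  have bil: "K_form \<mu> (f + g) h = K_form \<mu> f h + K_form \<mu> g h"
      "K_form \<mu> f (g + h) = K_form \<mu> f g + K_form \<mu> f h"
    if "f \<in> V" "g \<in> V" "h \<in> V" for f g h
    using int that by (simp_all add: K_form_def distrib_left distrib_right)
  have bil': "K_form \<mu> (c *\<^sub>R f) h = c * K_form \<mu> f h"
      "K_form \<mu> f (c *\<^sub>R h) = c * K_form \<mu> f h"
    if "f \<in> V" "h \<in> V" for f h c
    using int that by (simp_all add: K_form_def scaleR_fun_def mult.assoc mult.left_commute)
  obtain bs where bs: "is_basis_of bs V"
    using ex_basis_M_space unfolding V_def by blast
  define T where "T = (\<lambda>g f. if f \<in> V then K_form \<mu> f g else 0)"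
  have "form_rank V (K_form \<mu>) = vec_space.rank (length bs) (form_matrix (K_form \<mu>) bs)"
    by (rule form_rank_eq[OF bs]) (simp_all add: bil bil')
  also have "\<dots> = dim (T ` V)"
    unfolding T_def by (rule rank_form_matrix[OF bs]) (simp_all add: bil bil')
  also have "\<dots> = dim (restrict_zero (msupport \<mu>) ` V)"
  proof (rule dim_image_eq_if_same_kernel[OF V linear_restrict_zero])
    fix f assume f: "f \<in> V"
    show "T f = 0 \<longleftrightarrow> restrict_zero (msupport \<mu>) f = 0"
    proof
      assume "T f = 0"
      \<comment> \<open>Evaluating the functional \<open>T f\<close> at \<open>f\<close> itself
        gives the integral of a square.\<close>
      hence "T f f = 0" by simp
      hence "(LINT x|\<mu>. f x * f x) = 0"
        using f by (simp add: T_def K_form_def)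
      hence "AE x in \<mu>. f x * f x = 0"
        using integral_nonneg_eq_0_iff_AE[OF int[OF f f]] by simp
      hence AE: "AE x in \<mu>. f x = 0" by simp
      have "f x = 0" if "x \<in> msupport \<mu>" for x
        using continuous_AE_zero_on_msupport[OF sets cont[OF f] AE that] .
      thus "restrict_zero (msupport \<mu>) f = 0"
        by (auto simp: restrict_zero_def)
    next
      assume "restrict_zero (msupport \<mu>) f = 0"
      hence f0: "f x = 0" if "x \<in> msupport \<mu>" for x
        using that by (auto simp: restrict_zero_def fun_eq_iff split: if_splits)
      have "AE x in \<mu>. g x * f x = 0" for g
        using AE_in_msupport[OF sets] by eventually_elim (simp add: f0)
      hence "K_form \<mu> g f = 0" for g
        unfolding K_form_def by (rule integral_eq_zero_AE)
      thus "T f = 0" by (simp add: T_def fun_eq_iff)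
    qed
  qed (auto simp: T_def bil bil' fun_eq_iff fun_cong[OF scaleR_fun_def])
  finally show ?thesis unfolding V_def .
qed

theorem theorem5p12:
  fixes \<Gamma> :: "(real^'d::finite) set" and l :: "real^'d" and \<mu> :: "(real^'d) measure"
  assumes "convex_cone \<Gamma>" and "closed \<Gamma>" and "acute \<Gamma>" and "solid \<Gamma>"
    and "l \<in> interior \<Gamma>"
    and "sets \<mu> = sets (restrict_space borel (dual_cone \<Gamma>))"
    and "finite_measure \<mu>"
  shows "finitely_supported \<mu> \<longleftrightarrow>
    (\<exists>n::nat. n \<ge> 1 \<and>
      form_rank (M_space \<Gamma> l n) (K_form \<mu>) = form_rank (M_space \<Gamma> l (n + 1)) (K_form \<mu>))"
proof -
  define S where "S = msupport \<mu>"
  define W where "W = (\<lambda>n. restrict_zero S ` M_space \<Gamma> l n)"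
  have l: "l \<in> \<Gamma>" using assms(5) interior_subset by blast
  have S: "S \<subseteq> dual_cone \<Gamma>"
    using sets_eq_imp_space_eq[OF assms(6)] by (auto simp: S_def msupport_def space_restrict_space)
  have rank: "form_rank (M_space \<Gamma> l n) (K_form \<mu>) = dim (W n)" for n
    using form_rank_K_form[OF assms(5-7)] by (simp add: W_def S_def)
  have W_mono: "W n \<subseteq> W (n + 1)" for n
    unfolding W_def by (intro image_mono M_space_mono) simp
  have W_sub: "subspace (W n)" for n
    unfolding W_def by (rule linear_subspace_image[OF linear_restrict_zero subspace_M_space])
  have W_fin: "\<exists>B. finite B \<and> W n \<subseteq> span B" for n
  proof -
    obtain bs where "is_basis_of bs (M_space \<Gamma> l n)" using ex_basis_M_space by blast
    hence "W n = span (restrict_zero S ` set bs)"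
      unfolding W_def is_basis_of_def by (metis linear_span_image[OF linear_restrict_zero])
    thus ?thesis by (intro exI[of _ "restrict_zero S ` set bs"]) auto
  qed
  show ?thesis
    unfolding rank finitely_supported_def S_def[symmetric]
  proof
    assume fin: "finite S"
    let ?I = "(\<lambda>p. indicator {p}) ` S :: (real^'d \<Rightarrow> real) set"
    have le: "dim (W n) \<le> card ?I" for n
      unfolding W_def using fin restrict_zero_in_span_indicators[OF fin]
      by (intro dim_le_card) auto
    show "\<exists>n\<ge>1. dim (W n) = dim (W (n + 1))"
    proof (rule ccontr)
      assume neg: "\<not> ?thesis"
      have less: "dim (W n) < dim (W (n + 1))" if "n \<ge> 1" for n
        using neg that W_fin[of "n + 1"] dim_subset_finite[OF W_mono[of n]] le_neq_implies_less by blast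
      \<comment> \<open>The shift by one is there because strict growth is available only from index
        1 on. At \<open>n = Suc (card ?I)\<close> the bound \<open>le\<close> is violated.\<close>
      have "dim (W (Suc n)) \<ge> n" for n
        by (induction n) (use less in \<open>auto simp: Suc_le_eq intro: le_less_trans\<close>)
      from this[of "Suc (card ?I)"] le[of "Suc (Suc (card ?I))"] show False by simp
    qed
  next
    assume "\<exists>n\<ge>1. dim (W n) = dim (W (n + 1))"
    then obtain n where n: "dim (W n) = dim (W (n + 1))" by blast
    obtain B where B: "finite B" "W (n + 1) \<subseteq> span B" using W_fin by blast
    \<comment> \<open>Multiplication by a coordinate function maps \<open>W n\<close> into
      \<open>W (n + 1)\<close>, so this equality makes \<open>W n\<close> closed under it.\<close>
    have eq: "W n = W (n + 1)"
      using subspace_eq_if_dim_eq[OF W_sub W_mono B(2,1) n] .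
    \<comment> \<open>On the dual cone this is the square root of \<open>s\<close>, which has no
      zeros there; it belongs to \<open>M_space \<Gamma> l n\<close> for every
      \<open>n\<close>.\<close>
    let ?h = "gen_fun \<Gamma> l (\<lambda>_. 0) 0"
    show "finite S"
    proof (rule finite_if_separated_by_multipliers[OF W_sub[of n], where U = "coord_funs l"])
      show "W n \<subseteq> span B" "finite B" using B eq by simp_all
      show "(\<lambda>x. u x * f x) \<in> W n" if u: "u \<in> coord_funs l" and f: "f \<in> W n" for u f
      proof -
        obtain g where g: "g \<in> M_space \<Gamma> l n" "f = restrict_zero S g" using f by (auto simp: W_def)
        have "(\<lambda>x. u x * f x) = restrict_zero S (\<lambda>x. u x * g x)"
          by (auto simp: g(2) restrict_zero_def)
        thus ?thesis unfolding eq
          using coord_fun_mult_M_space[OF l u g(1)] by (simp add: W_def)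
      qed
      show "restrict_zero S ?h \<in> W n"
        unfolding W_def by (intro imageI gen_fun_in_M_space) (simp add: mindex_abs_def)
      show "restrict_zero S ?h x \<noteq> 0" if "x \<in> S" for x
        using that S inner_dual_cone_nonneg[OF l, of x]
        by (auto simp: restrict_zero_def gen_fun_def monomial_def)
      show "\<exists>u\<in>coord_funs l. u x \<noteq> u y" if "x \<in> S" "y \<in> S" "x \<noteq> y" for x y
        using that S inner_dual_cone_nonneg[OF l] by (intro coord_funs_separate) auto
    qed
  qed
qed

end
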